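(* Let $S$ be a $0$-simplifying Boolean inverse semigroup. Then exactly one of the following is true: (1) $S$ is atomless. (2) $S$ is semisimple.
   Context: For an inverse semigroup $S$, $\mathsf{E}(S)$ is its set of idempotents. The natural partial order is $a\le b$ iff $a=ba^{-1}a$; joins and meets refer to it; $a^{\downarrow}=\{x: x\le a\}$. Elements $a,b$ are compatible, $a\sim b$, if $a^{-1}b$ and $ab^{-1}$ are both idempotents. A Boolean algebra here means a generalized Boolean algebra: a distributive lattice with bottom (a top is not required) in which every principal order-ideal is a (unital) Boolean algebra. An inverse semigroup with zero is distributive if any two compatible elements have a join and multiplication distributes on both sides over such joins; it is Boolean if in addition $(\mathsf{E}(S),\le)$ is a Boolean algebra. An additive ideal of a Boolean inverse semigroup $S$ is a non-empty subset $I$ with $SI,IS\subseteq I$ such that $a,b\in I$ and $a\sim b$ imply $a\vee b\in I$. $S$ is $0$-simplifying if $S\ne\{0\}$ and its only additive ideals are $\{0\}$ and $S$. An atom is a non-zero element $a$ such that $x\le a$ implies $x=a$ or $x=0$; $S$ is atomless if it has no atoms. $S$ is semisimple if $a^{\downarrow}$ is finite for each $a\in S$. *)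

theory Defs
  imports "HOL-Algebra.Lattice"
begin

locale distributive_lattice = lattice +
  assumes meet_join_distrib:
    "\<lbrakk>x \<in> carrier L; y \<in> carrier L; z \<in> carrier L\<rbrakk>
      \<Longrightarrow> x \<sqinter> (y \<squnion> z) = (x \<sqinter> y) \<squnion> (x \<sqinter> z)"

locale unital_boolean_algebra = distributive_lattice + bounded_lattice +
  assumes complement_exists:
    "x \<in> carrier L \<Longrightarrow> \<exists>y\<in>carrier L. x \<squnion> y = \<top> \<and> x \<sqinter> y = \<bottom>"

locale generalized_boolean_algebra = distributive_lattice + weak_partial_order_bottom +
  assumes principal_ideal_boolean:
    "x \<in> carrier L \<Longrightarrow> unital_boolean_algebra (L\<lparr>carrier := {y \<in> carrier L. y \<sqsubseteq> x}\<rparr>)"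

locale inverse_semigroup = semigroup mult
  for mult :: "'a \<Rightarrow> 'a \<Rightarrow> 'a"  (infixl \<open>\<cdot>\<close> 70) +
  assumes unique_inverse: "\<exists>!b. a \<cdot> b \<cdot> a = a \<and> b \<cdot> a \<cdot> b = b"
begin

definition sinv :: "'a \<Rightarrow> 'a"
  where "sinv a = (THE b. a \<cdot> b \<cdot> a = a \<and> b \<cdot> a \<cdot> b = b)"

definition idempotents :: "'a set"
  where "idempotents = {e. e \<cdot> e = e}"

definition nle :: "'a \<Rightarrow> 'a \<Rightarrow> bool"  (infix \<open>\<preceq>\<close> 50)
  where "a \<preceq> b \<longleftrightarrow> a = b \<cdot> sinv a \<cdot> a"

definition compatible :: "'a \<Rightarrow> 'a \<Rightarrow> bool"  (infix \<open>\<sim>\<close> 50)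
  where "a \<sim> b \<longleftrightarrow> sinv a \<cdot> b \<in> idempotents \<and> a \<cdot> sinv b \<in> idempotents"

definition natural_order :: "'a gorder"
  where "natural_order = \<lparr>carrier = UNIV, eq = (=), le = (\<preceq>)\<rparr>"

definition idempotent_order :: "'a gorder"
  where "idempotent_order = \<lparr>carrier = idempotents, eq = (=), le = (\<preceq>)\<rparr>"

text \<open>Joins of elements are taken in the whole semigroup and need not exist, so they are
  given as a relation: \<open>c\<close> is the join of \<open>a\<close> and \<open>b\<close>.\<close>

definition is_join :: "'a \<Rightarrow> 'a \<Rightarrow> 'a \<Rightarrow> bool"
  where "is_join c a b \<longleftrightarrow> is_lub natural_order c {a, b}"

definition semisimple :: bool
  where "semisimple \<longleftrightarrow> (\<forall>a. finite {x. x \<preceq> a})"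

end

locale inverse_semigroup_zero = inverse_semigroup mult
  for mult :: "'a \<Rightarrow> 'a \<Rightarrow> 'a"  (infixl \<open>\<cdot>\<close> 70) +
  fixes zero :: 'a  (\<open>\<zero>\<close>)
  assumes zero_left: "\<zero> \<cdot> a = \<zero>"
    and zero_right: "a \<cdot> \<zero> = \<zero>"
begin

definition atom :: "'a \<Rightarrow> bool"
  where "atom a \<longleftrightarrow> a \<noteq> \<zero> \<and> (\<forall>x. x \<preceq> a \<longrightarrow> x = a \<or> x = \<zero>)"

definition atomless :: bool
  where "atomless \<longleftrightarrow> \<not> (\<exists>a. atom a)"

end

locale distributive_inverse_semigroup = inverse_semigroup_zero +
  assumes compatible_join_exists: "a \<sim> b \<Longrightarrow> \<exists>c. is_join c a b"
    and mult_join_left: "\<lbrakk>a \<sim> b; is_join c a b\<rbrakk> \<Longrightarrow> is_join (s \<cdot> c) (s \<cdot> a) (s \<cdot> b)"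
    and mult_join_right: "\<lbrakk>a \<sim> b; is_join c a b\<rbrakk> \<Longrightarrow> is_join (c \<cdot> s) (a \<cdot> s) (b \<cdot> s)"

locale boolean_inverse_semigroup = distributive_inverse_semigroup +
  assumes idempotents_boolean: "generalized_boolean_algebra idempotent_order"
begin

definition additive_ideal :: "'a set \<Rightarrow> bool"
  where "additive_ideal I \<longleftrightarrow>
    I \<noteq> {} \<and>
    (\<forall>s. \<forall>a\<in>I. s \<cdot> a \<in> I \<and> a \<cdot> s \<in> I) \<and>
    (\<forall>a\<in>I. \<forall>b\<in>I. \<forall>c. a \<sim> b \<and> is_join c a b \<longrightarrow> c \<in> I)"

definition zero_simplifying :: bool
  where "zero_simplifying \<longleftrightarrow>
    (UNIV :: 'a set) \<noteq> {\<zero>} \<and> (\<forall>I. additive_ideal I \<longrightarrow> I = {\<zero>} \<or> I = UNIV)"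

end

end

theory Submission
  imports Defs
begin

text \<open>
  The elements with finitely many elements below them form an additive ideal as soon as there is
  one. Indeed, restricting to an idempotent is compatible with all the operations involved:
  an element below \<open>s \<cdot> a\<close> is \<open>s \<cdot> y\<close> for some \<open>y\<close> below \<open>a\<close>, and dually for \<open>a \<cdot> s\<close>; and
  since multiplication distributes over compatible joins, an element below a join \<open>c\<close> of \<open>a\<close> and
  \<open>b\<close> is itself the join of an element below \<open>a\<close> and an element below \<open>b\<close>.

  An atom has at most two elements below it, so when there is an atom this ideal is non-zero.
  If the semigroup is \<open>0\<close>-simplifying, the ideal is then everything, which is semisimplicity.
  Conversely a semisimple semigroup with a non-zero element has an atom, namely a minimal non-zero
  element below the given one, so the two alternatives exclude each other.

  The natural order is handled through the description ``\<open>a \<preceq> b\<close> iff \<open>a = b \<cdot> e\<close> for an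
  idempotent \<open>e\<close>'', which rests on the commutation of idempotents.
\<close>

context inverse_semigroup
begin

lemma sinv_inverse: "a \<cdot> sinv a \<cdot> a = a" "sinv a \<cdot> a \<cdot> sinv a = sinv a"
  using theI'[OF unique_inverse[of a]] unfolding sinv_def by blast+

lemma sinv_unique: "a \<cdot> b \<cdot> a = a \<Longrightarrow> b \<cdot> a \<cdot> b = b \<Longrightarrow> sinv a = b"
  using unique_inverse[of a] sinv_inverse[of a] by blast

lemma idempotentD: "e \<in> idempotents \<Longrightarrow> e \<cdot> e = e"
  by (simp add: idempotents_def)

lemma sinv_mult_self_idempotent: "sinv a \<cdot> a \<in> idempotents"
  by (simp add: idempotents_def sinv_inverse flip: assoc)

text \<open>
  With \<open>x\<close> the inverse of \<open>e \<cdot> f\<close>, the element \<open>f \<cdot> x \<cdot> e\<close> is also an inverse of \<open>e \<cdot> f\<close>, and it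
  is idempotent. It is therefore \<open>x\<close>, and as an idempotent it is its own inverse, so it equals
  \<open>e \<cdot> f\<close>.
\<close>

lemma idempotents_mult_closed:
  assumes "e \<in> idempotents" "f \<in> idempotents"
  shows "e \<cdot> f \<in> idempotents"
proof -
  define x where "x = sinv (e \<cdot> f)"
  have ee: "e \<cdot> e = e" "\<And>z. e \<cdot> (e \<cdot> z) = e \<cdot> z"
    and ff: "f \<cdot> f = f" "\<And>z. f \<cdot> (f \<cdot> z) = f \<cdot> z"
    using assms by (simp_all add: idempotents_def flip: assoc)
  have x1: "e \<cdot> (f \<cdot> (x \<cdot> (e \<cdot> f))) = e \<cdot> f" and x2: "x \<cdot> (e \<cdot> (f \<cdot> x)) = x"
    using sinv_inverse[of "e \<cdot> f"] by (simp_all add: x_def assoc)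
  have x3: "x \<cdot> (e \<cdot> (f \<cdot> (x \<cdot> z))) = x \<cdot> z" for z
    using arg_cong[OF x2, of "\<lambda>w. w \<cdot> z"] by (simp add: assoc)
  have "x = f \<cdot> x \<cdot> e"
    unfolding x_def
    by (rule sinv_unique; fold x_def; simp add: assoc ee ff x1 x3)
  moreover have "(f \<cdot> x \<cdot> e) \<cdot> (f \<cdot> x \<cdot> e) = f \<cdot> x \<cdot> e"
    by (simp add: assoc x3)
  ultimately have xx: "x \<cdot> x = x"
    by simp
  have "sinv x = x"
    by (rule sinv_unique) (simp_all add: xx)
  moreover have "sinv x = e \<cdot> f"
    by (rule sinv_unique) (simp_all add: assoc x1 x2)
  ultimately show ?thesis
    using xx by (simp add: idempotents_def)
qed

text \<open>Both \<open>e \<cdot> f\<close> and \<open>f \<cdot> e\<close> are inverses of the idempotent \<open>e \<cdot> f\<close>.\<close>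

lemma idempotents_commute:
  assumes e: "e \<in> idempotents" and f: "f \<in> idempotents"
  shows "e \<cdot> f = f \<cdot> e"
proof -
  have ee: "\<And>z. e \<cdot> (e \<cdot> z) = e \<cdot> z" and ff: "\<And>z. f \<cdot> (f \<cdot> z) = f \<cdot> z"
    using assms by (simp_all add: idempotents_def flip: assoc)
  have ef: "e \<cdot> (f \<cdot> (e \<cdot> f)) = e \<cdot> f" and fe: "f \<cdot> (e \<cdot> (f \<cdot> e)) = f \<cdot> e"
    using idempotents_mult_closed[OF e f] idempotents_mult_closed[OF f e]
    by (simp_all add: idempotents_def assoc)
  have "sinv (e \<cdot> f) = e \<cdot> f"
    by (rule sinv_unique) (simp_all add: assoc ef)
  moreover have "sinv (e \<cdot> f) = f \<cdot> e"
    by (rule sinv_unique) (simp_all add: assoc ee ff ef fe)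
  ultimately show ?thesis by simp
qed

text \<open>
  With \<open>b = a \<cdot> e\<close>, the order demands \<open>a \<cdot> (sinv b \<cdot> b) = b\<close>. The idempotent \<open>sinv b \<cdot> b\<close>
  absorbs \<open>e\<close> on the right, hence also on the left, where \<open>e\<close> turns \<open>a\<close> into \<open>b\<close>.
\<close>

lemma mult_idempotent_nle:
  assumes e: "e \<in> idempotents"
  shows "a \<cdot> e \<preceq> a"
proof -
  define b where "b = a \<cdot> e"
  have "b \<cdot> e = b"
    using e by (simp add: b_def assoc idempotentD)
  then have "a \<cdot> (sinv b \<cdot> b) = a \<cdot> (sinv b \<cdot> b \<cdot> e)"
    by (simp add: assoc)
  also have "\<dots> = a \<cdot> (e \<cdot> (sinv b \<cdot> b))"
    using idempotents_commute[OF e sinv_mult_self_idempotent[of b]] by simp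
  also have "\<dots> = b"
    using sinv_inverse(1)[of b] by (simp add: b_def assoc)
  finally show ?thesis
    by (simp add: nle_def assoc flip: b_def)
qed

lemma nle_iff: "a \<preceq> b \<longleftrightarrow> (\<exists>e\<in>idempotents. a = b \<cdot> e)"
  using mult_idempotent_nle sinv_mult_self_idempotent
  by (metis assoc nle_def)

lemma nle_refl: "a \<preceq> a"
  using sinv_inverse(1)[of a] by (simp add: nle_def)

lemma nle_trans: "a \<preceq> b \<Longrightarrow> b \<preceq> c \<Longrightarrow> a \<preceq> c"
  unfolding nle_iff using idempotents_mult_closed assoc by metis

lemma nle_antisym:
  assumes "a \<preceq> b" "b \<preceq> a"
  shows "a = b"
proof -
  obtain e f where ef: "e \<in> idempotents" "f \<in> idempotents" "a = b \<cdot> e" "b = a \<cdot> f"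
    using assms unfolding nle_iff by blast
  have "b \<cdot> f = b"
    using ef by (metis assoc idempotentD)
  then have "b \<cdot> (f \<cdot> e) = a"
    using ef(3) by (simp flip: assoc)
  moreover have "b \<cdot> (e \<cdot> f) = b"
    using ef(3,4) by (simp flip: assoc)
  ultimately show ?thesis
    using idempotents_commute[OF ef(1,2)] by simp
qed

lemma is_join_unique:
  assumes "is_join c a b" "is_join d a b"
  shows "c = d"
  using assms
  by (intro nle_antisym) (auto simp: is_join_def least_def natural_order_def)

lemma finite_down_mult_left:
  assumes "finite {x. x \<preceq> a}"
  shows "finite {x. x \<preceq> s \<cdot> a}"
proof (rule finite_subset)
  show "{x. x \<preceq> s \<cdot> a} \<subseteq> (\<lambda>y. s \<cdot> y) ` {y. y \<preceq> a}"
    using mult_idempotent_nle by (auto simp: nle_iff[of _ "s \<cdot> a"] assoc)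
qed (simp add: assms)

lemma finite_down_mult_right:
  assumes "finite {x. x \<preceq> a}"
  shows "finite {x. x \<preceq> a \<cdot> s}"
proof (rule finite_subset)
  show "{x. x \<preceq> a \<cdot> s} \<subseteq> (\<lambda>y. y \<cdot> s) ` {y. y \<preceq> a}"
  proof
    fix x assume "x \<in> {x. x \<preceq> a \<cdot> s}"
    then obtain e where e: "e \<in> idempotents" "x = a \<cdot> s \<cdot> e"
      by (auto simp: nle_iff)
    \<comment> \<open>Conjugating \<open>e\<close> by \<open>s\<close> gives an idempotent that effects the restriction
      from between \<open>a\<close> and \<open>s\<close>.\<close>
    define f where "f = s \<cdot> e \<cdot> sinv s"
    have comm: "e \<cdot> (sinv s \<cdot> s) = sinv s \<cdot> s \<cdot> e"
      using idempotents_commute[OF e(1) sinv_mult_self_idempotent] .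
    have fs: "f \<cdot> s = s \<cdot> e"
    proof -
      have "f \<cdot> s = s \<cdot> (e \<cdot> (sinv s \<cdot> s))"
        by (simp add: f_def assoc)
      also have "\<dots> = s \<cdot> sinv s \<cdot> s \<cdot> e"
        unfolding comm by (simp add: assoc)
      finally show ?thesis by (simp add: sinv_inverse)
    qed
    have "f \<cdot> f = f \<cdot> s \<cdot> (e \<cdot> sinv s)"
      by (simp add: f_def assoc)
    also have "\<dots> = s \<cdot> (e \<cdot> e) \<cdot> sinv s"
      unfolding fs by (simp add: assoc)
    also have "\<dots> = f"
      using e(1) by (simp add: f_def idempotentD)
    finally have "a \<cdot> f \<preceq> a"
      by (simp add: mult_idempotent_nle idempotents_def)
    moreover have "x = a \<cdot> f \<cdot> s"
      using fs by (simp add: e(2) assoc)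
    ultimately show "x \<in> (\<lambda>y. y \<cdot> s) ` {y. y \<preceq> a}"
      by blast
  qed
qed (simp add: assms)

end

context inverse_semigroup_zero
begin

text \<open>A non-zero element with the fewest elements below it is an atom, because a smaller one
  has strictly fewer.\<close>

lemma semisimple_imp_atom_exists:
  assumes "semisimple" "a \<noteq> \<zero>"
  shows "\<exists>b. atom b"
proof -
  obtain b where b: "b \<noteq> \<zero>"
    and least: "\<And>y. y \<noteq> \<zero> \<Longrightarrow> card {x. x \<preceq> b} \<le> card {x. x \<preceq> y}"
    using ex_has_least_nat[of "\<lambda>y. y \<noteq> \<zero>" a "\<lambda>y. card {x. x \<preceq> y}"] assms(2) by blast
  have "y = b" if "y \<preceq> b" "y \<noteq> \<zero>" for y
  proof (rule ccontr)
    assume "y \<noteq> b"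
    then have "\<not> b \<preceq> y"
      using that(1) nle_antisym by blast
    then have "{x. x \<preceq> y} \<subset> {x. x \<preceq> b}"
      using that(1) nle_trans nle_refl by blast
    then have "card {x. x \<preceq> y} < card {x. x \<preceq> b}"
      using assms(1) by (simp add: semisimple_def psubset_card_mono)
    with least[OF that(2)] show False by simp
  qed
  with b show ?thesis
    unfolding atom_def by blast
qed

lemma atom_finite_down:
  assumes "atom a"
  shows "finite {x. x \<preceq> a}"
proof (rule finite_subset)
  show "{x. x \<preceq> a} \<subseteq> {a, \<zero>}"
    using assms by (auto simp: atom_def)
qed simp

end

text \<open>An element \<open>c \<cdot> e\<close> below a join \<open>c\<close> of \<open>a\<close> and \<open>b\<close> is a join of \<open>a \<cdot> e\<close> and \<open>b \<cdot> e\<close>, so it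
  is determined by a pair of elements below \<open>a\<close> and \<open>b\<close>.\<close>

lemma (in distributive_inverse_semigroup) finite_down_join:
  assumes "a \<sim> b" "is_join c a b" "finite {x. x \<preceq> a}" "finite {x. x \<preceq> b}"
  shows "finite {x. x \<preceq> c}"
proof (rule finite_subset)
  show "{x. x \<preceq> c} \<subseteq> (\<lambda>(u, v). THE w. is_join w u v) ` ({x. x \<preceq> a} \<times> {x. x \<preceq> b})"
  proof
    fix x assume "x \<in> {x. x \<preceq> c}"
    then obtain e where e: "e \<in> idempotents" "x = c \<cdot> e"
      by (auto simp: nle_iff)
    have "is_join x (a \<cdot> e) (b \<cdot> e)"
      using mult_join_right[OF assms(1,2)] e(2) by simp
    then have "x = (THE w. is_join w (a \<cdot> e) (b \<cdot> e))"
      using is_join_unique by (metis the_equality)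
    then show "x \<in> (\<lambda>(u, v). THE w. is_join w u v) ` ({x. x \<preceq> a} \<times> {x. x \<preceq> b})"
      using e(1) mult_idempotent_nle by force
  qed
qed (simp add: assms)

context boolean_inverse_semigroup
begin

lemma additive_ideal_finite_down:
  assumes "finite {x. x \<preceq> a}"
  shows "additive_ideal {a. finite {x. x \<preceq> a}}"
  using assms finite_down_mult_left finite_down_mult_right finite_down_join
  unfolding additive_ideal_def by blast

lemma atom_imp_semisimple:
  assumes "zero_simplifying" "atom a"
  shows "semisimple"
proof -
  let ?I = "{a. finite {x. x \<preceq> a}}"
  have "?I = {\<zero>} \<or> ?I = UNIV"
    using additive_ideal_finite_down[OF atom_finite_down[OF assms(2)]] assms(1)
    unfolding zero_simplifying_def by blast
  moreover have "a \<in> ?I" "a \<noteq> \<zero>"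
    using atom_finite_down[OF assms(2)] assms(2) by (auto simp: atom_def)
  ultimately have "?I = UNIV" by blast
  then show ?thesis
    unfolding semisimple_def by blast
qed

end

theorem theorem5p15:
  fixes mult :: "'a \<Rightarrow> 'a \<Rightarrow> 'a" and zero :: 'a
  assumes "boolean_inverse_semigroup mult zero"
    and "boolean_inverse_semigroup.zero_simplifying mult zero"
  shows "(inverse_semigroup_zero.atomless mult zero \<or> inverse_semigroup.semisimple mult) \<and>
    \<not> (inverse_semigroup_zero.atomless mult zero \<and> inverse_semigroup.semisimple mult)"
proof -
  interpret boolean_inverse_semigroup mult zero
    by (fact assms(1))
  have "\<exists>a. a \<noteq> zero"
    using assms(2) unfolding zero_simplifying_def by blast
  then show ?thesis
    using atom_imp_semisimple[OF assms(2)] semisimple_imp_atom_exists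
    unfolding atomless_def by blast
qed

end
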